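(* Let $T\ge 1$ be the number of phases, let $\mathbf{f}$ be given data, let $\mathbf{g}_0(\mathbf{f},\theta(0))$ be the initialization network, let $\mathbf{g}(\mathbf{u},\theta(t))$ be the network map from one state to the next, and let $\ell$ be the loss function of the final state. For $\Theta=(\theta(0),\dots,\theta(T))$, $\mathbf{U}=(\mathbf{u}(0),\dots,\mathbf{u}(T))$ and $\Lambda=(\lambda(0),\dots,\lambda(T))$ define the Lagrangian $$L(\mathbf{U},\Theta;\Lambda)=\ell(\mathbf{u}(T))+\langle\lambda(0),\mathbf{u}(0)-\mathbf{g}_0(\mathbf{f},\theta(0))\rangle+\sum_{t=1}^{T}\langle\lambda(t),\mathbf{u}(t)-\mathbf{g}(\mathbf{u}(t-1),\theta(t))\rangle .$$ Let $\Theta^k=(\theta^k(0),\dots,\theta^k(T))$ be given and let $(\mathbf{U}^k,\Lambda^k)$, with $\mathbf{U}^k=(\mathbf{u}^k(0),\dots,\mathbf{u}^k(T))$ and $\Lambda^k=(\lambda^k(0),\dots,\lambda^k(T))$, be obtained from $\Theta^k$ by the first-order optimality conditions listed in the context. Then, with $(\mathbf{U}^k,\Lambda^k)$ fixed and $\Theta$ the variable, $$\partial_\Theta L(\mathbf{U}^k,\Theta;\Lambda^k)=\partial_\Theta\,\ell\big(\mathbf{u}^k(T)(\Theta)\big).$$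
   Context: The setting is the discrete-time optimal control problem of minimizing $\ell(\mathbf{u}(T))$ over $\Theta$ subject to $\mathbf{u}(0)=\mathbf{g}_0(\mathbf{f},\theta(0))$ and $\mathbf{u}(t)=\mathbf{g}(\mathbf{u}(t-1),\theta(t))$ for $t=1,\dots,T$. Here $\mathbf{f}$ is the partial k-space data, $\mathbf{u}(t)\in\mathbb{C}^{m\times n\times c}$ is the multi-coil image at phase $t$, the $\theta(t)$ are the network parameters (control variables), and the $\lambda(t)$ are the Lagrange multipliers. The loss $\ell(\mathbf{u}(T))$ measures the discrepancy between the final state and a reference image. All derivatives written are taken to exist, and $\langle\cdot,\cdot\rangle$ is the inner product on the image space (complex images being treated through their real and imaginary parts). With $\Theta=\Theta^k$ fixed, the pair is defined as $(\mathbf{U}^k,\Lambda^k):=\arg\min_{\mathbf{U},\Lambda}L(\mathbf{U},\Theta^k;\Lambda)$ and is computed from the first-order optimality conditions in $\Lambda$ and $\mathbf{U}$: $\mathbf{u}^k(0)=\mathbf{g}_0(\mathbf{f},\theta^k(0))$; $\mathbf{u}^k(t)=\mathbf{g}(\mathbf{u}^k(t-1),\theta^k(t))$ for $t=1,\dots,T$; $\lambda^k(T)=-\partial_{\mathbf{u}(T)}\ell(\mathbf{u}^k(T))$; $\lambda^k(t)=\langle\lambda^k(t+1),\partial_{\mathbf{u}(t)}\mathbf{g}(\mathbf{u}^k(t),\theta^k(t+1))\rangle$ for $t=0,\dots,T-1$. Then $(\mathbf{U}^k,\Lambda^k)$ is held fixed and the gradient of $L$ in $\Theta$ is $\partial_{\theta(t)}L(\mathbf{U}^k,\theta(t);\Lambda^k)=-\langle\lambda^k(t),\partial_{\theta(t)}\mathbf{g}(\mathbf{u}^k(t-1),\theta(t))\rangle$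 for $t=1,\dots,T$, and $\partial_{\theta(0)}L(\mathbf{U}^k,\theta(0);\Lambda^k)=-\langle\lambda^k(0),\partial_{\theta(0)}\mathbf{g}_0(\mathbf{f},\theta(0))\rangle$. The notation $\mathbf{u}^k(T)(\Theta)$ means the final state $\mathbf{u}^k(T)$ regarded as a function of the network parameters $\Theta$, on which it depends through the state recursion above.
   Formalization: The equality of the two gradients in Θ (as tuples of partial gradients in θ(0),…,θ(T)) is asserted at Θ = Θ^k, the parameters from which (U^k, Λ^k) are computed; with (U^k, Λ^k) held fixed it fails in general at other Θ. *)

theory Defs
  imports "HOL-Analysis.Analysis"
begin

text \<open>
  Multi-coil images in C^(m x n x c). The inner product inherited from
  \<^class>\<open>euclidean_space\<close> is the real one, i.e. the sum over all entries of
  Re z * Re w + Im z * Im w, so that real derivatives, gradients and adjoints treat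
  an image through its real and imaginary parts.
\<close>
type_synonym ('m, 'n, 'c) image = "complex ^ 'c ^ 'n ^ 'm"

text \<open>
  Network parameters: \<open>(\<theta>(0), \<theta>)\<close> with \<open>\<theta> t\<close> meaningful for \<open>1 \<le> t \<le> T\<close> only.
  The first component is kept apart since the initialization network may have a
  parameter space different from that of the state transition network. Likewise, states and
  multipliers are sequences of images of which only the entries \<open>0, \<dots>, T\<close> are used.
\<close>
type_synonym ('q, 'p) params = "'q \<times> (nat \<Rightarrow> 'p)"

definition lagrangian ::
  "nat \<Rightarrow> (('m::finite, 'n::finite, 'c::finite) image \<Rightarrow> real)
   \<Rightarrow> ('f \<Rightarrow> 'q \<Rightarrow> ('m, 'n, 'c) image) \<Rightarrow> (('m, 'n, 'c) image \<Rightarrow> 'p \<Rightarrow> ('m, 'n, 'c) image) \<Rightarrow> 'f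
   \<Rightarrow> (nat \<Rightarrow> ('m, 'n, 'c) image) \<Rightarrow> ('q, 'p) params \<Rightarrow> (nat \<Rightarrow> ('m, 'n, 'c) image) \<Rightarrow> real"
  where
  "lagrangian T loss g0 g f U \<Theta> \<Lambda> =
     loss (U T) + \<Lambda> 0 \<bullet> (U 0 - g0 f (fst \<Theta>))
     + (\<Sum>t = 1..T. \<Lambda> t \<bullet> (U t - g (U (t - 1)) (snd \<Theta> t)))"

primrec state ::
  "('f \<Rightarrow> 'q \<Rightarrow> 'u) \<Rightarrow> ('u \<Rightarrow> 'p \<Rightarrow> 'u) \<Rightarrow> 'f \<Rightarrow> ('q, 'p) params \<Rightarrow> nat \<Rightarrow> 'u"
  where
  "state g0 g f \<Theta> 0 = g0 f (fst \<Theta>)"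
| "state g0 g f \<Theta> (Suc t) = g (state g0 g f \<Theta> t) (snd \<Theta> (Suc t))"

text \<open>
  Existence of the partial derivatives of the loss and of the two networks along \<open>U\<close> and \<open>\<Theta>\<close>.
  Only derivatives in one argument at a time are required, not joint differentiability of \<open>g\<close>.
\<close>
definition partial_derivatives_exist ::
  "nat \<Rightarrow> (('m::finite, 'n::finite, 'c::finite) image \<Rightarrow> real)
   \<Rightarrow> ('f \<Rightarrow> 'q::euclidean_space \<Rightarrow> ('m, 'n, 'c) image)
   \<Rightarrow> (('m, 'n, 'c) image \<Rightarrow> 'p::euclidean_space \<Rightarrow> ('m, 'n, 'c) image) \<Rightarrow> 'f
   \<Rightarrow> (nat \<Rightarrow> ('m, 'n, 'c) image) \<Rightarrow> ('q, 'p) params \<Rightarrow> bool"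
  where
  "partial_derivatives_exist T loss g0 g f U \<Theta> \<longleftrightarrow>
     loss differentiable at (U T) \<and>
     (\<forall>t<T. (\<lambda>v. g v (snd \<Theta> (t + 1))) differentiable at (U t)) \<and>
     (\<forall>t\<in>{1..T}. (\<lambda>x. g (U (t - 1)) x) differentiable at (snd \<Theta> t)) \<and>
     (\<lambda>x. g0 f x) differentiable at (fst \<Theta>)"

text \<open>
  First-order optimality conditions in the multipliers (state recursion) and in the states
  (adjoint recursion). \<open>GDERIV loss u :> D\<close> says that \<open>D\<close> is the gradient of \<open>loss\<close> at \<open>u\<close>; the pairing of
  a multiplier with the derivative of \<open>g\<close> is the adjoint of that derivative applied to the multiplier.
\<close>
definition first_order_conditions ::
  "nat \<Rightarrow> (('m::finite, 'n::finite, 'c::finite) image \<Rightarrow> real)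
   \<Rightarrow> ('f \<Rightarrow> 'q \<Rightarrow> ('m, 'n, 'c) image) \<Rightarrow> (('m, 'n, 'c) image \<Rightarrow> 'p \<Rightarrow> ('m, 'n, 'c) image) \<Rightarrow> 'f
   \<Rightarrow> ('q, 'p) params \<Rightarrow> (nat \<Rightarrow> ('m, 'n, 'c) image) \<Rightarrow> (nat \<Rightarrow> ('m, 'n, 'c) image) \<Rightarrow> bool"
  where
  "first_order_conditions T loss g0 g f \<Theta> U \<Lambda> \<longleftrightarrow>
     U 0 = g0 f (fst \<Theta>) \<and>
     (\<forall>t\<in>{1..T}. U t = g (U (t - 1)) (snd \<Theta> t)) \<and>
     (GDERIV loss (U T) :> - \<Lambda> T) \<and>
     (\<forall>t<T. \<Lambda> t =
        adjoint (frechet_derivative (\<lambda>v. g v (snd \<Theta> (t + 1))) (at (U t))) (\<Lambda> (t + 1)))"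

text \<open>
  \<open>G\<close> is the gradient of \<open>F\<close> in the parameters at \<open>\<Theta>\<close>: the tuple of the partial gradients in
  \<open>\<theta>(0), \<dots>, \<theta>(T)\<close>, each of which is required to exist (and is then unique).
\<close>
definition has_param_gradient ::
  "nat \<Rightarrow> (('q::euclidean_space, 'p::euclidean_space) params \<Rightarrow> real)
   \<Rightarrow> ('q, 'p) params \<Rightarrow> ('q, 'p) params \<Rightarrow> bool"
  where
  "has_param_gradient T F G \<Theta> \<longleftrightarrow>
     (GDERIV (\<lambda>x. F (x, snd \<Theta>)) (fst \<Theta>) :> fst G) \<and>
     (\<forall>t\<in>{1..T}. GDERIV (\<lambda>x. F (fst \<Theta>, (snd \<Theta>)(t := x))) (snd \<Theta> t) :> snd G t)"

end

theory Submission
  imports Defs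
begin

text \<open>
  The result is the adjoint (backpropagation) form of the chain rule. A multiplier \<open>\<Lambda> t\<close> is minus
  the gradient of the final loss with respect to the state at phase \<open>t\<close>, all later phases being run
  with the parameters \<open>\<Theta>\<close>: this is the terminal condition for \<open>t = T\<close>, and the adjoint recursion
  carries it from \<open>t + 1\<close> to \<open>t\<close>. It is stated as \<open>adjoint_chain_rule\<close>: if a trajectory depends on a
  variable \<open>x\<close> and its state at phase \<open>s\<close> has derivative \<open>D\<close>, then the final loss has derivative
  \<open>h \<mapsto> - (\<Lambda> s \<bullet> D h)\<close>.

  Varying the single parameter \<open>\<theta>(t)\<close> leaves the states before phase \<open>t\<close> unchanged, and the state at
  phase \<open>t\<close> is then \<open>g (U (t - 1)) x\<close>. Its derivative \<open>B\<close> therefore yields the derivative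
  \<open>h \<mapsto> - (\<Lambda> t \<bullet> B h)\<close> of the final loss. In the Lagrangian with states and multipliers held fixed,
  the only term that varies is \<open>- \<Lambda> t \<bullet> g (U (t - 1)) x\<close>, which has the same derivative; the
  initialization is treated in the same way. The common gradient is the adjoint of \<open>B\<close> applied to
  the multiplier, with a minus sign.
\<close>

lemma GDERIV_uminus_adjoint:
  fixes B :: "'a::euclidean_space \<Rightarrow> 'u::euclidean_space"
  assumes "linear B" and "(F has_derivative (\<lambda>h. - (l \<bullet> B h))) (at x)"
  shows "GDERIV F x :> - adjoint B l"
  using assms(2) by (simp add: gderiv_def adjoint_works[OF assms(1)] inner_commute)

text \<open>
  The trajectory is followed from phase \<open>s\<close> on only: the derivative \<open>D\<close> of the state at phase \<open>s\<close> is
  pushed forward to phase \<open>T\<close>, while the multiplier is pulled back.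
\<close>
lemma adjoint_chain_rule:
  fixes loss :: "'u::euclidean_space \<Rightarrow> real"
    and g :: "'u \<Rightarrow> 'p \<Rightarrow> 'u"
    and X :: "nat \<Rightarrow> 'a::real_normed_vector \<Rightarrow> 'u"
  assumes loss: "GDERIV loss (U T) :> - \<Lambda> T"
    and diff: "\<And>t. t < T \<Longrightarrow> (\<lambda>v. g v (\<theta> (Suc t))) differentiable at (U t)"
    and adj: "\<And>t. t < T \<Longrightarrow>
      \<Lambda> t = adjoint (frechet_derivative (\<lambda>v. g v (\<theta> (Suc t))) (at (U t))) (\<Lambda> (Suc t))"
    and "s \<le> T"
    and base: "\<And>t. \<lbrakk>s \<le> t; t \<le> T\<rbrakk> \<Longrightarrow> X t x = U t"
    and step: "\<And>t y. \<lbrakk>s \<le> t; t < T\<rbrakk> \<Longrightarrow> X (Suc t) y = g (X t y) (\<theta> (Suc t))"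
    and D: "(X s has_derivative D) (at x)"
  shows "((\<lambda>y. loss (X T y)) has_derivative (\<lambda>h. - (\<Lambda> s \<bullet> D h))) (at x)"
  using \<open>s \<le> T\<close> base step D
proof (induction s arbitrary: D rule: inc_induct)
  case base
  have "(loss has_derivative (\<lambda>h. h \<bullet> - \<Lambda> T)) (at (X T x))"
    using loss base.prems(1) by (simp add: gderiv_def)
  from has_derivative_compose[OF base.prems(3) this] show ?case
    by (simp add: inner_commute)
next
  case (step s)
  let ?A = "frechet_derivative (\<lambda>v. g v (\<theta> (Suc s))) (at (U s))"
  have d: "(\<lambda>v. g v (\<theta> (Suc s))) differentiable at (U s)"
    using diff step.hyps by simp
  have A: "((\<lambda>v. g v (\<theta> (Suc s))) has_derivative ?A) (at (X s x))"
    using frechet_derivative_works d step.prems(1)[of s] step.hyps by auto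
  have "X (Suc s) = (\<lambda>y. g (X s y) (\<theta> (Suc s)))"
    using step.prems(2)[of s] step.hyps by auto
  then have "(X (Suc s) has_derivative (\<lambda>h. ?A (D h))) (at x)"
    using has_derivative_compose[OF step.prems(3) A] by simp
  then have "((\<lambda>y. loss (X T y)) has_derivative (\<lambda>h. - (\<Lambda> (Suc s) \<bullet> ?A (D h)))) (at x)"
    by (intro step.IH) (auto intro: step.prems)
  moreover have "\<Lambda> (Suc s) \<bullet> ?A v = \<Lambda> s \<bullet> v" for v
    using adjoint_works[OF linear_frechet_derivative[OF d], of v "\<Lambda> (Suc s)"] adj[of s] step.hyps
    by (simp add: inner_commute)
  ultimately show ?case by simp
qed

lemma state_eqI:
  assumes "U 0 = g0 f (fst \<Theta>)"
    and "\<And>s. s < t \<Longrightarrow> U (Suc s) = g (U s) (snd \<Theta> (Suc s))"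
  shows "state g0 g f \<Theta> t = U t"
  using assms by (induction t) auto

lemma state_cong_prefix:
  assumes "fst \<Theta> = fst \<Theta>'" and "\<And>s. s \<in> {1..t} \<Longrightarrow> snd \<Theta> s = snd \<Theta>' s"
  shows "state g0 g f \<Theta> t = state g0 g f \<Theta>' t"
  using assms by (induction t) auto

lemma lagrangian_update_init:
  "lagrangian T loss g0 g f U (x, \<theta>) \<Lambda> =
     lagrangian T loss g0 g f U (q, \<theta>) \<Lambda> + \<Lambda> 0 \<bullet> g0 f q - \<Lambda> 0 \<bullet> g0 f x"
  by (simp add: lagrangian_def inner_diff_right)

lemma lagrangian_update_phase:
  assumes "t \<in> {1..T}"
  shows "lagrangian T loss g0 g f U (q, \<theta>(t := x)) \<Lambda> =
     lagrangian T loss g0 g f U (q, \<theta>) \<Lambda> + \<Lambda> t \<bullet> g (U (t - 1)) (\<theta> t) - \<Lambda> t \<bullet> g (U (t - 1)) x"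
proof -
  have "(\<Sum>s\<in>{1..T} - {t}. \<Lambda> s \<bullet> (U s - g (U (s - 1)) ((\<theta>(t := x)) s))) =
        (\<Sum>s\<in>{1..T} - {t}. \<Lambda> s \<bullet> (U s - g (U (s - 1)) (\<theta> s)))"
    by (rule sum.cong) auto
  moreover have "sum F {1..T} = F t + sum F ({1..T} - {t})" for F :: "nat \<Rightarrow> real"
    using assms by (intro sum.remove) auto
  ultimately show ?thesis
    unfolding lagrangian_def fst_conv snd_conv by (simp only: fun_upd_same inner_diff_right)
qed

theorem theorem3p1:
  fixes T :: nat
    and f :: 'f
    and g0 :: "'f \<Rightarrow> 'q::euclidean_space \<Rightarrow> ('m::finite, 'n::finite, 'c::finite) image"
    and g :: "('m, 'n, 'c) image \<Rightarrow> 'p::euclidean_space \<Rightarrow> ('m, 'n, 'c) image"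
    and loss :: "('m, 'n, 'c) image \<Rightarrow> real"
    and \<Theta>k :: "('q, 'p) params"
    and Uk \<Lambda>k :: "nat \<Rightarrow> ('m, 'n, 'c) image"
  assumes "T \<ge> 1"
    and "partial_derivatives_exist T loss g0 g f Uk \<Theta>k"
    and "first_order_conditions T loss g0 g f \<Theta>k Uk \<Lambda>k"
  shows "\<exists>G. has_param_gradient T (\<lambda>\<Theta>. lagrangian T loss g0 g f Uk \<Theta> \<Lambda>k) G \<Theta>k \<and>
             has_param_gradient T (\<lambda>\<Theta>. loss (state g0 g f \<Theta> T)) G \<Theta>k"
proof -
  obtain q \<theta> where \<Theta>: "\<Theta>k = (q, \<theta>)" by (cases \<Theta>k)
  note ex = assms(2)[unfolded partial_derivatives_exist_def \<Theta> fst_conv snd_conv]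
  note foc = assms(3)[unfolded first_order_conditions_def \<Theta> fst_conv snd_conv]
  have U0: "Uk 0 = g0 f q" using foc by simp
  have US: "Uk (Suc t) = g (Uk t) (\<theta> (Suc t))" if "t < T" for t
    using foc that by (auto dest!: bspec[of _ _ "Suc t"])
  have state_U: "state g0 g f \<Theta>k t = Uk t" if "t \<le> T" for t
    using that by (intro state_eqI) (auto simp: \<Theta> U0 US)
  have loss: "GDERIV loss (Uk T) :> - \<Lambda>k T" using foc by simp
  have diff: "(\<lambda>v. g v (\<theta> (Suc t))) differentiable at (Uk t)" if "t < T" for t
    using ex that by simp
  have adj: "\<Lambda>k t = adjoint (frechet_derivative (\<lambda>v. g v (\<theta> (Suc t))) (at (Uk t))) (\<Lambda>k (Suc t))"
    if "t < T" for t
    using foc that by (metis Suc_eq_plus1)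
  note chain = adjoint_chain_rule[where g = g and \<theta> = \<theta> and U = Uk and \<Lambda> = \<Lambda>k, OF loss diff adj]

  define B0 where "B0 = frechet_derivative (g0 f) (at q)"
  define B where "B t = frechet_derivative (g (Uk (t - 1))) (at (\<theta> t))" for t
  have B0: "(g0 f has_derivative B0) (at q)"
    using ex unfolding B0_def by (simp add: frechet_derivative_works)
  have B: "(g (Uk (t - 1)) has_derivative B t) (at (\<theta> t))" if "t \<in> {1..T}" for t
    using ex that unfolding B_def by (simp add: frechet_derivative_works)
  define G where "G = (- adjoint B0 (\<Lambda>k 0), \<lambda>t. - adjoint (B t) (\<Lambda>k t))"

  have "has_param_gradient T (\<lambda>\<Theta>. lagrangian T loss g0 g f Uk \<Theta> \<Lambda>k) G \<Theta>k"
    unfolding has_param_gradient_def \<Theta> G_def fst_conv snd_conv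
  proof (intro conjI ballI GDERIV_uminus_adjoint)
    show "linear B0" using B0 by (rule has_derivative_linear)
    show "((\<lambda>x. lagrangian T loss g0 g f Uk (x, \<theta>) \<Lambda>k) has_derivative (\<lambda>h. - (\<Lambda>k 0 \<bullet> B0 h))) (at q)"
      by (subst lagrangian_update_init[where q = q])
        (rule derivative_eq_intros B0 refl | simp)+
  next
    fix t assume t: "t \<in> {1..T}"
    show "linear (B t)" using B[OF t] by (rule has_derivative_linear)
    show "((\<lambda>x. lagrangian T loss g0 g f Uk (q, \<theta>(t := x)) \<Lambda>k)
            has_derivative (\<lambda>h. - (\<Lambda>k t \<bullet> B t h))) (at (\<theta> t))"
      by (subst lagrangian_update_phase[OF t])
        (rule derivative_eq_intros B[OF t] refl | simp)+
  qed
  moreover have "has_param_gradient T (\<lambda>\<Theta>. loss (state g0 g f \<Theta> T)) G \<Theta>k"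
    unfolding has_param_gradient_def \<Theta> G_def fst_conv snd_conv
  proof (intro conjI ballI GDERIV_uminus_adjoint)
    show "linear B0" using B0 by (rule has_derivative_linear)
    show "((\<lambda>x. loss (state g0 g f (x, \<theta>) T)) has_derivative (\<lambda>h. - (\<Lambda>k 0 \<bullet> B0 h))) (at q)"
    proof (rule chain)
      show "state g0 g f (q, \<theta>) s = Uk s" if "s \<le> T" for s
        using state_U[OF that] by (simp add: \<Theta>)
      show "((\<lambda>x. state g0 g f (x, \<theta>) 0) has_derivative B0) (at q)"
        using B0 by simp
    qed simp_all
  next
    fix t assume t: "t \<in> {1..T}"
    show "linear (B t)" using B[OF t] by (rule has_derivative_linear)
    let ?X = "\<lambda>s x. state g0 g f (q, \<theta>(t := x)) s"
    obtain r where r: "t = Suc r" using t by (cases t) auto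
    have "?X r x = state g0 g f (q, \<theta>) r" for x
      using r by (intro state_cong_prefix) auto
    then have Xt: "?X t x = g (Uk (t - 1)) x" for x
      using r t state_U[of r] by (simp add: \<Theta>)
    show "((\<lambda>x. loss (?X T x)) has_derivative (\<lambda>h. - (\<Lambda>k t \<bullet> B t h))) (at (\<theta> t))"
    proof (rule chain)
      show "t \<le> T" using t by simp
      show "?X s (\<theta> t) = Uk s" if "s \<le> T" for s
        using state_U[OF that] by (simp add: \<Theta>)
      show "?X (Suc s) y = g (?X s y) (\<theta> (Suc s))" if "t \<le> s" for s y
        using that by simp
      show "(?X t has_derivative B t) (at (\<theta> t))"
        unfolding Xt by (rule B[OF t])
    qed
  qed
  ultimately show ?thesis by blast
qed

end
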